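(* Assume that $s:E\to\mathbb R$ has finite support and satisfies the finite balanced condition. Then there exists a unique $\vartheta:E\to\mathbb R$ with finite support such that $\Phi(\vartheta)=s$.
   Context: The Farey tessellation $\mathfrak F$ is the ideal triangulation of the unit disk $\mathbb D$ (hyperbolic metric) obtained from the ideal triangle with vertices $1,\mathrm i,-1$ by repeated hyperbolic reflections across edges; $V\subset\mathbb T$ is its vertex set, $E$ its set of (unoriented) edges. $\mathrm{fan}(v)$ is the set of edges incident to $v\in V$. Finite balanced condition for $s:E\to\mathbb R$: for every $v\in V$, only finitely many $e\in\mathrm{fan}(v)$ have $s(e)\ne0$, and $\sum_{e\in\mathrm{fan}(v)}s(e)=0$. The linear map $\Phi:\mathbb R^E\to\mathbb R^E$ from diamond shears to shears: for $e=(a,c)\in E$, let $a,b,c,d$ be, in counterclockwise order, the vertices of the quad formed by the two triangles of $\mathfrak F$ containing $e$, and let $e_1=(a,b)$, $e_2=(b,c)$, $e_3=(c,d)$, $e_4=(d,a)$; then $\Phi(\vartheta)(e)=-\vartheta(e_1)+\vartheta(e_2)-\vartheta(e_3)+\vartheta(e_4)$. (Diamond shear functions are originally functions on the edges $E^*$ of the dual tree of $\mathfrak F$, which are identified with $E$ by duality.) *)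

theory Defs
  imports Complex_Main "HOL-Library.FuncSet"
begin

text \<open>
  Hyperbolic reflection of the disk model across the geodesic with distinct endpoints \<open>a\<close>, \<open>b\<close> on
  the unit circle, extended to the circle. The geodesic is a diameter if \<open>a + b = 0\<close>; otherwise it
  lies on the circle orthogonal to the unit circle at \<open>a\<close> and \<open>b\<close>, whose centre is the intersection
  \<open>2ab/(a + b)\<close> of the two tangents to the unit circle, and the reflection is inversion in it.
\<close>
definition hyp_reflection :: "complex \<Rightarrow> complex \<Rightarrow> complex \<Rightarrow> complex" where
  "hyp_reflection a b z =
     (if a + b = 0 then a\<^sup>2 * cnj z
      else let p = 2 * a * b / (a + b) in p + of_real ((dist a p)\<^sup>2) / cnj (z - p))"

text \<open>
  An ideal triangle is represented by the set of its three ideal vertices, and a geodesic by the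
  set of its two endpoints.
\<close>
inductive_set farey_triangles :: "complex set set" where
  base: "{1, \<i>, -1} \<in> farey_triangles"
| reflect: "T \<in> farey_triangles \<Longrightarrow> a \<in> T \<Longrightarrow> b \<in> T \<Longrightarrow> a \<noteq> b \<Longrightarrow>
    hyp_reflection a b ` T \<in> farey_triangles"

definition farey_vertices :: "complex set" where
  "farey_vertices = \<Union> farey_triangles"

definition farey_edges :: "complex set set" where
  "farey_edges = {{a, b} | a b. a \<noteq> b \<and> (\<exists>T\<in>farey_triangles. a \<in> T \<and> b \<in> T)}"

definition fan :: "complex \<Rightarrow> complex set set" where
  "fan v = {e \<in> farey_edges. v \<in> e}"

definition support :: "(complex set \<Rightarrow> real) \<Rightarrow> complex set set" where
  "support f = {e \<in> farey_edges. f e \<noteq> 0}"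

definition finite_balanced :: "(complex set \<Rightarrow> real) \<Rightarrow> bool" where
  "finite_balanced s \<longleftrightarrow>
     (\<forall>v\<in>farey_vertices.
        finite {e \<in> fan v. s e \<noteq> 0} \<and> (\<Sum>e | e \<in> fan v \<and> s e \<noteq> 0. s e) = 0)"

definition ccw_on_circle :: "complex \<Rightarrow> complex \<Rightarrow> complex \<Rightarrow> complex \<Rightarrow> bool" where
  "ccw_on_circle a b c d \<longleftrightarrow>
     (\<exists>\<alpha> \<beta> \<gamma> \<delta>. \<alpha> < \<beta> \<and> \<beta> < \<gamma> \<and> \<gamma> < \<delta> \<and> \<delta> < \<alpha> + 2 * pi \<and>
        a = cis \<alpha> \<and> b = cis \<beta> \<and> c = cis \<gamma> \<and> d = cis \<delta>)"

definition farey_quad :: "complex \<Rightarrow> complex \<Rightarrow> complex \<Rightarrow> complex \<Rightarrow> bool" where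
  "farey_quad a b c d \<longleftrightarrow>
     {a, b, c} \<in> farey_triangles \<and> {c, d, a} \<in> farey_triangles \<and> ccw_on_circle a b c d"

text \<open>
  The two labellings \<open>(a, b, c, d)\<close> and \<open>(c, d, a, b)\<close> of the quad around \<open>e = {a, c}\<close> give the same
  value, so the description below determines it. Elements of \<open>\<real>\<^sup>E\<close> are the functions in
  \<open>farey_edges \<rightarrow>\<^sub>E UNIV\<close>, which makes equality of functions mean equality on the edges.
\<close>
definition Phi :: "(complex set \<Rightarrow> real) \<Rightarrow> (complex set \<Rightarrow> real)" where
  "Phi \<theta> = (\<lambda>e\<in>farey_edges. THE x. \<exists>a b c d. e = {a, c} \<and> farey_quad a b c d \<and>
     x = - \<theta> {a, b} + \<theta> {b, c} - \<theta> {c, d} + \<theta> {d, a})"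

end

(* A primitive integer vector (x, y), up to sign, is encoded by the point z / cnj z of the unit
   circle, z = x + i y. The vertices of the Farey tessellation are these points, its edges come from
   the pairs u, w with determinant 1, and the two triangles on such an edge have third vertices
   u + w and w - u. The norm form Q(x, y) = x^2 - x y + y^2 has the base triangle as its set of
   minimal vectors, and it strictly increases as one moves away from that triangle; the depth of an
   edge is the larger value of Q at its ends.

   Uniqueness: if e = {u, w} has maximal depth in the support of theta and u + w is the vertex on the
   outer side, then all edges of the quad around {u, u + w} except e are deeper than e, so
   Phi(theta) takes the value theta(e) at {u, u + w}.

   Existence: let {u, u + w} be an edge of maximal depth in the support of s. In the fan of u + w only
   {u, u + w} and {u + w, w} are not deeper, so by balance s has opposite values on them. Subtracting
   a multiple of the image of the indicator of {u, w}, which is balanced, removes both and otherwise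
   changes only shallower edges. This stops at a function supported on the base triangle, where
   balance at the three vertices forces it to vanish. *)
theory Submission
  imports Defs "HOL-Library.Product_Plus"
begin

subsection \<open>Primitive vectors as points of the circle\<close>

definition cross :: "int \<times> int \<Rightarrow> int \<times> int \<Rightarrow> int" where
  "cross u w = fst u * snd w - snd u * fst w"

text \<open>Coprimality of the coordinates in Bezout form, which supplies a completing vector
  directly.\<close>

definition primitive :: "int \<times> int \<Rightarrow> bool" where
  "primitive u \<longleftrightarrow> (\<exists>w. cross u w = 1)"

lemma cross_add_left: "cross (u + v) w = cross u w + cross v w"
  and cross_add_right: "cross u (v + w) = cross u v + cross u w"
  and cross_diff_left: "cross (u - v) w = cross u w - cross v w"
  and cross_diff_right: "cross u (v - w) = cross u v - cross u w"
  and cross_minus_left: "cross (- u) w = - cross u w"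
  and cross_minus_right: "cross u (- w) = - cross u w"
  and cross_self: "cross u u = 0"
  and cross_zero_left [simp]: "cross 0 w = 0"
  and cross_zero_right [simp]: "cross u 0 = 0"
  by (simp_all add: cross_def algebra_simps)

lemmas cross_simps = cross_add_left cross_add_right cross_diff_left cross_diff_right
  cross_minus_left cross_minus_right cross_self

lemma cross_commute: "cross w u = - cross u w"
  by (simp add: cross_def)

lemma cross_neq_0_imp:
  assumes "cross u w \<noteq> 0"
  shows "u \<noteq> 0" "w \<noteq> 0" "u + w \<noteq> 0" "u - w \<noteq> 0"
  using assms cross_add_left[of u w w] cross_diff_left[of u w w] by (auto simp: cross_self)

lemma primitiveI: "\<bar>cross u w\<bar> = 1 \<Longrightarrow> primitive u"
  unfolding primitive_def by (metis abs_if cross_minus_right)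

lemma primitiveI': "\<bar>cross w u\<bar> = 1 \<Longrightarrow> primitive u"
  by (rule primitiveI[of _ w]) (simp add: cross_commute[of w u])

lemma primitive_nonzero: "primitive u \<Longrightarrow> u \<noteq> 0"
  by (auto simp: primitive_def cross_def)

text \<open>A vector parallel to the primitive \<open>u\<close> is an integer multiple
  \<open>k\<close> of it, and primitivity of \<open>w\<close> makes \<open>k\<close> a unit.\<close>

lemma primitive_parallel:
  assumes "primitive u" "primitive w" "cross u w = 0"
  shows "w = u \<or> w = - u"
proof -
  obtain u' w' where u': "cross u u' = 1" and w': "cross w w' = 1"
    using assms unfolding primitive_def by blast
  define k where "k = cross w u'"
  \<comment> \<open>Cramer's rule for \<open>w\<close> in the basis \<open>u\<close>,
    \<open>u'\<close>; the coefficient of \<open>u'\<close> is \<open>cross u w\<close>, which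
    vanishes.\<close>
  have "fst w * cross u u' = k * fst u + cross u w * fst u'"
    "snd w * cross u u' = k * snd u + cross u w * snd u'"
    by (simp_all add: k_def cross_def algebra_simps)
  then have w: "fst w = k * fst u" "snd w = k * snd u"
    using u' assms(3) by simp_all
  then have "k * cross u w' = 1"
    using w' by (simp add: cross_def algebra_simps)
  then have "k = 1 \<or> k = -1"
    using zmult_eq_1_iff by blast
  then show ?thesis
    using w by (auto simp: prod_eq_iff)
qed

section \<open>Gaussian integers and their ideal points\<close>

definition gauss :: "int \<times> int \<Rightarrow> complex" where
  "gauss u = Complex (of_int (fst u)) (of_int (snd u))"

text \<open>The quotient is the square of the direction of \<open>gauss u\<close>: arguments double,
  opposite vectors give the same point, and a half turn of directions covers the circle
  once.\<close>

definition ideal_point :: "int \<times> int \<Rightarrow> complex" where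
  "ideal_point u = gauss u / cnj (gauss u)"

lemma gauss_add: "gauss (u + w) = gauss u + gauss w"
  and gauss_diff: "gauss (u - w) = gauss u - gauss w"
  and gauss_minus: "gauss (- u) = - gauss u"
  by (simp_all add: gauss_def complex_eq_iff)

lemma gauss_eq_0_iff: "gauss u = 0 \<longleftrightarrow> u = 0"
  by (auto simp: gauss_def complex_eq_iff prod_eq_iff)

lemma Im_cnj_gauss_mult: "Im (cnj (gauss u) * gauss w) = of_int (cross u w)"
  by (simp add: gauss_def cross_def)

lemma ideal_point_minus [simp]: "ideal_point (- u) = ideal_point u"
  by (simp add: ideal_point_def gauss_minus)

lemma ideal_point_diff_commute: "ideal_point (u - w) = ideal_point (w - u)"
  using ideal_point_minus[of "w - u"] by simp

lemma norm_ideal_point: "u \<noteq> 0 \<Longrightarrow> norm (ideal_point u) = 1"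
  by (simp add: ideal_point_def norm_divide gauss_eq_0_iff)

text \<open>The left side is the numerator of \<open>ideal_point u - ideal_point w\<close>, so two
  ideal points coincide only if the determinant vanishes.\<close>

lemma gauss_cross:
  "gauss u * cnj (gauss w) - gauss w * cnj (gauss u) = - 2 * \<i> * of_int (cross u w)"
  by (simp add: gauss_def cross_def complex_eq_iff algebra_simps)

lemma ideal_point_eq_iff:
  assumes "primitive u" "primitive w"
  shows "ideal_point u = ideal_point w \<longleftrightarrow> w = u \<or> w = - u"
proof
  assume "ideal_point u = ideal_point w"
  then have "gauss u * cnj (gauss w) - gauss w * cnj (gauss u) = 0"
    using assms[THEN primitive_nonzero]
    by (simp add: ideal_point_def gauss_eq_0_iff field_simps)
  then have "cross u w = 0"
    using gauss_cross[of u w] by simp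
  then show "w = u \<or> w = - u"
    by (rule primitive_parallel[OF assms])
qed auto

lemma ideal_point_neq:
  assumes "cross u w \<noteq> 0"
  shows "ideal_point u \<noteq> ideal_point w"
proof
  assume eq: "ideal_point u = ideal_point w"
  have "u \<noteq> 0" "w \<noteq> 0"
    using assms by (auto simp: cross_def)
  with eq have "gauss u * cnj (gauss w) - gauss w * cnj (gauss u) = 0"
    by (simp add: ideal_point_def gauss_eq_0_iff field_simps)
  then show False
    using gauss_cross[of u w] assms by simp
qed

subsection \<open>Reflections\<close>

lemma cnj_unit: "norm z = 1 \<Longrightarrow> cnj z = 1 / z"
  using complex_norm_square[of z] by (cases "z = 0") (simp_all add: eq_divide_eq mult.commute)

text \<open>On the unit circle conjugation is inversion, so the reflection agrees there with the
  Moebius involution fixing \<open>a\<close> and \<open>b\<close>. One formula covers diameters and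
  arcs.\<close>

lemma hyp_reflection_circle:
  assumes a: "norm a = 1" and b: "norm b = 1" and z: "norm z = 1" and ab: "a \<noteq> b"
  shows "hyp_reflection a b z = (2 * a * b - (a + b) * z) / (a + b - 2 * z)"
proof (cases "a + b = 0")
  case True
  then have "b = - a"
    by (simp add: eq_neg_iff_add_eq_0 add.commute)
  moreover have "cnj z = 1 / z"
    using z by (rule cnj_unit)
  ultimately show ?thesis
    using True by (simp add: hyp_reflection_def power2_eq_square)
next
  case False
  define p where "p = 2 * a * b / (a + b)"
  have nz: "a \<noteq> 0" "b \<noteq> 0" "z \<noteq> 0"
    using a b z by auto
  have c: "cnj a = 1 / a" "cnj b = 1 / b" "cnj z = 1 / z"
    using a b z by (auto intro: cnj_unit)
  have cp: "cnj p = 2 / (a + b)"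
    using False nz by (simp add: p_def c field_simps)
  \<comment> \<open>If the denominator vanished, \<open>z\<close> would be the midpoint of
    \<open>a\<close> and \<open>b\<close> and, by conjugation, also their harmonic mean; the two
    means agree only for \<open>a = b\<close>.\<close>
  have zz: "a + b - 2 * z \<noteq> 0"
  proof
    assume "a + b - 2 * z = 0"
    then have z2: "2 * z = a + b"
      by simp
    then have "cnj (2 * z) = cnj (a + b)"
      by (rule arg_cong)
    then have "2 * a * b = z * (a + b)"
      using nz by (simp add: c field_simps)
    then have "(a - b)\<^sup>2 = 0"
      using z2 by algebra
    then have "a = b"
      by simp
    with ab show False ..
  qed
  have "complex_of_real ((dist a p)\<^sup>2) = (a - p) * cnj (a - p)"
    by (simp only: dist_norm complex_norm_square)
  also have "\<dots> = (a - p) * (1 / a - 2 / (a + b))"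
    by (simp add: cp c)
  also have "a - p = a * (a - b) / (a + b)"
    using False by (simp add: p_def field_simps)
  also have "1 / a - 2 / (a + b) = - ((a - b) / (a * (a + b)))"
    using False nz by (simp add: divide_simps)
  also have "a * (a - b) / (a + b) * (- ((a - b) / (a * (a + b)))) = - ((a - b) / (a + b))\<^sup>2"
    using nz by (simp add: power2_eq_square)
  finally have d: "complex_of_real ((dist a p)\<^sup>2) = - ((a - b) / (a + b))\<^sup>2" .
  have e: "cnj (z - p) = (a + b - 2 * z) / (z * (a + b))"
    using False nz by (simp add: cp c field_simps)
  have "hyp_reflection a b z = p + of_real ((dist a p)\<^sup>2) / cnj (z - p)"
    using False by (simp add: hyp_reflection_def Let_def p_def)
  also have "\<dots> = p - ((a - b) / (a + b))\<^sup>2 * (z * (a + b)) / (a + b - 2 * z)"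
    unfolding d e by simp
  also have "\<dots> = (2 * a * b - (a + b) * z) / (a + b - 2 * z)"
    using False zz nz unfolding p_def by (simp add: divide_simps) algebra
  finally show ?thesis .
qed

lemma hyp_reflection_commute:
  assumes "norm a = 1" "norm b = 1" "norm z = 1" "a \<noteq> b"
  shows "hyp_reflection a b z = hyp_reflection b a z"
  using assms by (simp add: hyp_reflection_circle ac_simps)

lemma hyp_reflection_fixes:
  assumes "norm a = 1" "norm b = 1" "a \<noteq> b"
  shows "hyp_reflection a b a = a" "hyp_reflection a b b = b"
  using assms by (simp_all add: hyp_reflection_circle divide_simps) (simp_all add: algebra_simps)

text \<open>On directions the reflection acts as the linear map that fixes \<open>u\<close> and
  negates \<open>w\<close>, hence it exchanges sum and difference.\<close>

lemma hyp_reflection_ideal_point: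
  assumes uw: "cross u w \<noteq> 0"
  shows "hyp_reflection (ideal_point u) (ideal_point w) (ideal_point (u + w)) =
    ideal_point (u - w)"
proof -
  note nz = cross_neq_0_imp[OF uw]
  define x y c d where "x = gauss u" "y = gauss w" "c = cnj (gauss u)" "d = cnj (gauss w)"
  note defs = this
  have nz': "c \<noteq> 0" "d \<noteq> 0" "c + d \<noteq> 0" "c - d \<noteq> 0"
    using nz gauss_eq_0_iff[of u] gauss_eq_0_iff[of w] gauss_eq_0_iff[of "u + w"]
      gauss_eq_0_iff[of "u - w"]
    unfolding gauss_add gauss_diff defs by (simp_all flip: complex_cnj_add complex_cnj_diff)
  define D where "D = x * d - y * c"
  have D: "D \<noteq> 0"
    using gauss_cross[of u w] uw by (simp add: defs D_def)
  \<comment> \<open>Numerator and denominator share the factor \<open>D / (c * d * (c + d))\<close>,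
    which is nonzero because \<open>D\<close> is a multiple of the determinant.\<close>
  have n: "2 * (x / c) * (y / d) - (x / c + y / d) * ((x + y) / (c + d)) =
      D * (y - x) / (c * d * (c + d))"
    and m: "x / c + y / d - 2 * ((x + y) / (c + d)) = D * (d - c) / (c * d * (c + d))"
    using nz' by (simp_all add: divide_simps D_def) algebra+
  have "hyp_reflection (ideal_point u) (ideal_point w) (ideal_point (u + w)) =
      (2 * (x / c) * (y / d) - (x / c + y / d) * ((x + y) / (c + d))) /
      (x / c + y / d - 2 * ((x + y) / (c + d)))"
    using nz ideal_point_neq[OF uw]
    by (subst hyp_reflection_circle) (simp_all add: norm_ideal_point,
        simp add: ideal_point_def gauss_add defs)
  also have "\<dots> = (y - x) / (d - c)"
    unfolding n m using D nz' by simp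
  also have "\<dots> = (x - y) / (c - d)"
    using nz' by (simp add: divide_simps) (simp add: algebra_simps)
  also have "\<dots> = ideal_point (u - w)"
    by (simp add: ideal_point_def gauss_diff defs)
  finally show ?thesis .
qed

section \<open>Farey triangles as unimodular pairs\<close>

definition farey_triangle :: "int \<times> int \<Rightarrow> int \<times> int \<Rightarrow> complex set" where
  "farey_triangle u w = {ideal_point u, ideal_point w, ideal_point (u + w)}"

text \<open>Two moves of the modular group: \<open>(u + w, - u)\<close> permutes the vertices of the
  triangle cyclically (its cube is the sign change), and \<open>(w, - u)\<close> passes to the
  triangle across the side from \<open>u\<close> to \<open>w\<close>.\<close>

lemma farey_triangle_rotate: "farey_triangle (u + w) (- u) = farey_triangle u w"
  and farey_triangle_minus: "farey_triangle (- u) (- w) = farey_triangle u w"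
  and farey_triangle_opposite:
    "farey_triangle w (- u) = {ideal_point u, ideal_point w, ideal_point (u - w)}"
  using ideal_point_minus[of "u + w"] ideal_point_diff_commute[of u w]
  by (auto simp: farey_triangle_def add.commute)

text \<open>Rotation brings any side into leading position, so reflections have to be computed
  across the side \<open>{ideal_point u, ideal_point w}\<close> only.\<close>

lemma farey_triangle_pair:
  assumes "cross u w = 1" "a \<in> farey_triangle u w" "b \<in> farey_triangle u w" "a \<noteq> b"
  obtains p q where "cross p q = 1" "farey_triangle p q = farey_triangle u w"
    "{a, b} = {ideal_point p, ideal_point q}"
proof -
  have r: "farey_triangle (u + w) (- u) = farey_triangle u w"
    "farey_triangle w (- (u + w)) = farey_triangle u w"
    "cross (u + w) (- u) = 1" "cross w (- (u + w)) = 1"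
    using farey_triangle_rotate[of u w] farey_triangle_rotate[of "u + w" "-u"] assms(1)
      cross_commute[of w u]
    by (simp_all add: cross_simps)
  have m: "ideal_point (- u) = ideal_point u" "ideal_point (- (u + w)) = ideal_point (u + w)"
    by (rule ideal_point_minus)+
  have "{a, b} = {ideal_point u, ideal_point w} \<or> {a, b} = {ideal_point (u + w), ideal_point u} \<or>
      {a, b} = {ideal_point w, ideal_point (u + w)}"
    using assms(2-4) unfolding farey_triangle_def by blast
  then show thesis
    using that[OF assms(1) refl] that[OF r(3,1), unfolded m] that[OF r(4,2), unfolded m] by blast
qed

lemma hyp_reflection_farey_triangle:
  assumes uw: "cross u w = 1" and ab: "{a, b} = {ideal_point u, ideal_point w}"
  shows "hyp_reflection a b ` farey_triangle u w = farey_triangle w (- u)"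
proof -
  have nz: "u \<noteq> 0" "w \<noteq> 0" "u + w \<noteq> 0"
    using uw cross_neq_0_imp[of u w] by simp_all
  have ne: "ideal_point u \<noteq> ideal_point w"
    using uw by (intro ideal_point_neq) simp
  have "hyp_reflection (ideal_point u) (ideal_point w) ` farey_triangle u w = farey_triangle w (- u)"
    unfolding farey_triangle_opposite using uw ne nz
    by (simp add: farey_triangle_def hyp_reflection_ideal_point
        hyp_reflection_fixes norm_ideal_point)
  moreover have "hyp_reflection (ideal_point w) (ideal_point u) ` farey_triangle u w =
      hyp_reflection (ideal_point u) (ideal_point w) ` farey_triangle u w"
    using nz ne by (intro image_cong refl hyp_reflection_commute)
      (auto simp: farey_triangle_def norm_ideal_point)
  ultimately show ?thesis
    using ab by (auto simp: doubleton_eq_iff)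
qed

lemma farey_triangles_subset:
  "T \<in> farey_triangles \<Longrightarrow> \<exists>u w. cross u w = 1 \<and> T = farey_triangle u w"
proof (induction rule: farey_triangles.induct)
  case base
  \<comment> \<open>The vectors \<open>(1, 0)\<close>, \<open>(0, 1)\<close>, \<open>(1, 1)\<close>
    give the points 1, -1, \<open>\<i>\<close>.\<close>
  have "{1, \<i>, -1} = farey_triangle (1, 0) (0, 1)"
    by (auto simp: farey_triangle_def ideal_point_def gauss_def complex_eq_iff divide_complex_def
        Complex_eq)
  then show ?case
    by (intro exI[of _ "(1, 0)"] exI[of _ "(0, 1)"]) (simp add: cross_def)
next
  case (reflect T a b)
  then obtain u w where "cross u w = 1" "T = farey_triangle u w"
    by blast
  then obtain p q where pq: "cross p q = 1" "T = farey_triangle p q"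
    "{a, b} = {ideal_point p, ideal_point q}"
    using farey_triangle_pair reflect.hyps by metis
  then have "hyp_reflection a b ` T = farey_triangle q (- p)"
    by (simp add: hyp_reflection_farey_triangle)
  moreover have "cross q (- p) = 1"
    using pq(1) by (simp add: cross_minus_right cross_commute[of q p])
  ultimately show ?case
    by blast
qed

subsection \<open>A norm form\<close>

text \<open>
  Any positive definite integral form would measure the distance to a base. For this one the polar
  form is odd on unimodular pairs, so it never vanishes there and every edge has a well-defined outer
  side.
\<close>
definition hex :: "int \<times> int \<Rightarrow> int" where
  "hex u = fst u * fst u - fst u * snd u + snd u * snd u"

definition hex_polar :: "int \<times> int \<Rightarrow> int \<times> int \<Rightarrow> int" where
  "hex_polar u w = 2 * fst u * fst w - fst u * snd w - snd u * fst w + 2 * snd u * snd w"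

lemma hex_polar_add_left: "hex_polar (u + v) w = hex_polar u w + hex_polar v w"
  and hex_polar_add_right: "hex_polar u (v + w) = hex_polar u v + hex_polar u w"
  and hex_polar_diff_left: "hex_polar (u - v) w = hex_polar u w - hex_polar v w"
  and hex_polar_diff_right: "hex_polar u (v - w) = hex_polar u v - hex_polar u w"
  and hex_polar_minus_left: "hex_polar (- u) w = - hex_polar u w"
  and hex_polar_minus_right: "hex_polar u (- w) = - hex_polar u w"
  and hex_polar_self: "hex_polar u u = 2 * hex u"
  by (simp_all add: hex_polar_def hex_def algebra_simps)

lemmas hex_polar_simps = hex_polar_add_left hex_polar_add_right hex_polar_diff_left
  hex_polar_diff_right hex_polar_minus_left hex_polar_minus_right hex_polar_self

lemma hex_polar_commute: "hex_polar w u = hex_polar u w"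
  by (simp add: hex_polar_def algebra_simps)

lemma hex_add: "hex (u + w) = hex u + hex w + hex_polar u w"
  and hex_diff: "hex (u - w) = hex u + hex w - hex_polar u w"
  and hex_minus [simp]: "hex (- u) = hex u"
  by (simp_all add: hex_polar_def hex_def algebra_simps)

lemma four_hex: "4 * hex u = (2 * fst u - snd u)\<^sup>2 + 3 * (snd u)\<^sup>2"
  by (simp add: hex_def power2_eq_square algebra_simps)

lemma hex_pos: "u \<noteq> 0 \<Longrightarrow> hex u > 0"
proof -
  assume "u \<noteq> 0"
  then have "4 * hex u > 0"
    unfolding four_hex by (cases "snd u = 0") (auto simp: prod_eq_iff intro: add_nonneg_pos)
  then show ?thesis by simp
qed

lemma hex_nonneg: "hex u \<ge> 0"
  using hex_pos[of u] by (cases "u = 0") (auto simp: hex_def)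

text \<open>The Gram determinant of a pair scales with the square of its determinant; the factor 3
  is minus the discriminant of the form.\<close>

lemma hex_discriminant: "4 * hex u * hex w = (hex_polar u w)\<^sup>2 + 3 * (cross u w)\<^sup>2"
  by (simp add: hex_def hex_polar_def cross_def power2_eq_square algebra_simps)

text \<open>By \<open>hex_discriminant\<close> an even value would make 3 divisible by 4. Oddness
  excludes the value 0 and also the even bounds \<open>2 * hex u\<close>, so weak reduction
  inequalities become strict.\<close>

lemma hex_polar_odd: "\<bar>cross u w\<bar> = 1 \<Longrightarrow> odd (hex_polar u w)"
proof
  assume "\<bar>cross u w\<bar> = 1" "even (hex_polar u w)"
  then obtain k where "hex_polar u w = 2 * k" by (auto elim: evenE)
  moreover have "(cross u w)\<^sup>2 = 1"
    using \<open>\<bar>cross u w\<bar> = 1\<close> by (metis one_power2 power2_abs)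
  ultimately have "4 * (hex u * hex w - k * k) = 3"
    using hex_discriminant[of u w] by (simp add: power2_eq_square algebra_simps)
  then show False by presburger
qed

text \<open>Completing the square in either variable bounds both coordinates by 1, which leaves the
  six minimal vectors of the hexagonal lattice: three up to sign, one for each base vertex.\<close>

lemma hex_eq_1: "hex u = 1 \<Longrightarrow> ideal_point u \<in> {1, \<i>, -1}"
proof -
  assume h: "hex u = 1"
  obtain x y where u: "u = (x, y)" by fastforce
  have "(2 * x - y)\<^sup>2 + 3 * y\<^sup>2 = 4"
    using four_hex[of u] h u by simp
  moreover have "(2 * y - x)\<^sup>2 + 3 * x\<^sup>2 = 4"
    using four_hex[of "(y, x)"] h u by (simp add: hex_def algebra_simps)
  ultimately have "y\<^sup>2 \<le> 1" "x\<^sup>2 \<le> 1"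
    using zero_le_power2[of "2 * x - y"] zero_le_power2[of "2 * y - x"] by linarith+
  then have "\<bar>y\<bar> \<le> 1" "\<bar>x\<bar> \<le> 1"
    by (simp_all add: abs_square_le_1)
  then have "x \<in> {-1, 0, 1}" "y \<in> {-1, 0, 1}"
    by auto
  then show ?thesis
    using h u by (auto simp: hex_def ideal_point_def gauss_def complex_eq_iff divide_complex_def
        Complex_eq)
qed

lemma abs_cross_1_imp:
  assumes "\<bar>cross u w\<bar> = 1"
  shows "u \<noteq> 0" "w \<noteq> 0" "hex u > 0" "hex w > 0" "4 * hex u * hex w = (hex_polar u w)\<^sup>2 + 3"
proof -
  have "cross u w \<noteq> 0"
    using assms by auto
  note nz = cross_neq_0_imp[OF this]
  then show "u \<noteq> 0" "w \<noteq> 0" "hex u > 0" "hex w > 0"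
    by (simp_all add: hex_pos)
  have "(cross u w)\<^sup>2 = 1"
    using assms by (metis one_power2 power2_abs)
  then show "4 * hex u * hex w = (hex_polar u w)\<^sup>2 + 3"
    using hex_discriminant[of u w] by simp
qed

text \<open>Gauss reduction: the base triangle is the only reduced one.\<close>
lemma hex_eq_1_if_short:
  assumes "\<bar>cross u w\<bar> = 1" "\<bar>hex_polar u w\<bar> < 2 * hex u" "hex u \<le> hex w"
  shows "hex u = 1" "hex w = 1" "\<bar>hex_polar u w\<bar> = 1"
proof -
  note h = abs_cross_1_imp[OF assms(1)]
  define p where "p = hex u - 1"
  have p: "p \<ge> 0" "hex u = p + 1"
    using h(3) by (simp_all add: p_def)
  have "\<bar>hex_polar u w\<bar> \<le> 2 * p + 1"
    using assms(2) p by simp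
  then have "(hex_polar u w)\<^sup>2 \<le> (2 * p + 1)\<^sup>2"
    using power_mono[of "\<bar>hex_polar u w\<bar>" "2 * p + 1" 2] by simp
  moreover have "4 * hex u * hex u \<le> 4 * hex u * hex w"
    using assms(3) h(3) by simp
  \<comment> \<open>After expansion this reads \<open>4 * p \<le> 0\<close>.\<close>
  ultimately have "4 * (p + 1) * (p + 1) \<le> (2 * p + 1)\<^sup>2 + 3"
    using h(5) p(2) by simp
  then have "p = 0"
    using p(1) by (simp add: power2_eq_square algebra_simps)
  then show u: "hex u = 1"
    using p by simp
  have "hex_polar u w \<noteq> 0"
    using hex_polar_odd[OF assms(1)] by auto
  then show b: "\<bar>hex_polar u w\<bar> = 1"
    using assms(2) u by simp
  then have "(hex_polar u w)\<^sup>2 = 1"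
    by (metis one_power2 power2_abs)
  then show "hex w = 1"
    using h(5) u by simp
qed

subsection \<open>Triangles, edges and vertices\<close>

text \<open>Descent on the total \<open>hex\<close> of the three vertices: reflecting across a side
  with positive polar form lowers it, and a triangle without such a side is the base
  triangle.\<close>

lemma farey_triangle_in_farey_triangles:
  "cross u w = 1 \<Longrightarrow> farey_triangle u w \<in> farey_triangles"
proof (induction "nat (hex u + hex w + hex (u + w))" arbitrary: u w rule: less_induct)
  case less
  have uw: "cross u w = 1"
    by fact
  \<comment> \<open>Crossing the side \<open>p\<close>, \<open>q\<close> trades \<open>p + q\<close>
    for \<open>q - p\<close> and lowers the total by \<open>2 * hex_polar p q\<close>; reflecting
    back recovers the original triangle. The claim is stated for all \<open>p\<close>,
    \<open>q\<close> so that it applies to each rotation of \<open>(u, w)\<close>.\<close>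
  have reduce: "farey_triangle p q \<in> farey_triangles"
    if pq: "cross p q = 1" "hex_polar p q > 0"
      and eq: "hex p + hex q + hex (p + q) = hex u + hex w + hex (u + w)" for p q
  proof -
    have *: "cross q (- p) = 1"
      using pq(1) by (simp add: cross_minus_right cross_commute[of q p])
    have "farey_triangle q (- p) \<in> farey_triangles"
    proof (rule less.hyps[OF _ *])
      have "hex q + hex (- p) + hex (q + - p) < hex u + hex w + hex (u + w)"
        using pq(2) eq by (simp add: hex_add hex_diff hex_polar_commute[of q p])
      then show "nat (hex q + hex (- p) + hex (q + - p)) < nat (hex u + hex w + hex (u + w))"
        using hex_nonneg[of q] hex_nonneg[of p] hex_nonneg[of "q + - p"] by (simp add: zless_nat_conj)
    qed
    moreover have "ideal_point q \<noteq> ideal_point p"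
      using pq(1) by (intro ideal_point_neq) (simp add: cross_commute[of q p])
    ultimately have "hyp_reflection (ideal_point q) (ideal_point p) ` farey_triangle q (- p)
        \<in> farey_triangles"
      by (intro farey_triangles.reflect) (auto simp: farey_triangle_def)
    also have "hyp_reflection (ideal_point q) (ideal_point p) ` farey_triangle q (- p) =
        farey_triangle (- p) (- q)"
      using * by (intro hyp_reflection_farey_triangle) auto
    finally show ?thesis
      by (simp add: farey_triangle_minus)
  qed
  show ?case
  proof (cases "hex_polar u w > 0")
    case True
    then show ?thesis
      using uw by (intro reduce) auto
  next
    case nonpos: False
    show ?thesis
    proof (cases "hex_polar (u + w) (- u) > 0")
      case True
      have "farey_triangle (u + w) (- u) \<in> farey_triangles"
        using uw True by (intro reduce) (simp_all add: cross_simps cross_commute[of w u])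
      then show ?thesis
        by (simp add: farey_triangle_rotate)
    next
      case nonpos': False
      show ?thesis
      proof (cases "hex_polar w (- (u + w)) > 0")
        case True
        have "farey_triangle w (- (u + w)) \<in> farey_triangles"
          using uw True hex_minus[of "u + w"] hex_minus[of u]
          by (intro reduce) (simp_all add: cross_simps cross_commute[of w u])
        then show ?thesis
          using farey_triangle_rotate[of "u + w" "- u"] by (simp add: farey_triangle_rotate)
      next
        case nonpos'': False
        have a: "\<bar>cross u w\<bar> = 1" "\<bar>cross w u\<bar> = 1"
          using uw by (simp_all add: cross_commute[of w u])
        \<comment> \<open>The three failed tests place \<open>hex_polar u w\<close> between 0 and
          both \<open>- 2 * hex u\<close> and \<open>- 2 * hex w\<close>; parity removes the lower
          endpoints.\<close>
        have "hex_polar u w \<noteq> 2 * hex u * - 1" "hex_polar u w \<noteq> 2 * hex w * - 1"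
          using hex_polar_odd[OF a(1)] by (metis dvd_mult2 dvd_triv_left)+
        then have b: "\<bar>hex_polar u w\<bar> < 2 * hex u" "\<bar>hex_polar w u\<bar> < 2 * hex w"
          using nonpos nonpos' nonpos'' hex_polar_commute[of u w]
          by (simp_all add: hex_polar_simps)
        have "hex u = 1 \<and> hex w = 1 \<and> \<bar>hex_polar u w\<bar> = 1"
        proof (cases "hex u \<le> hex w")
          case True
          then show ?thesis
            using hex_eq_1_if_short[OF a(1) b(1)] by simp
        next
          case False
          then show ?thesis
            using hex_eq_1_if_short[OF a(2) b(2)] hex_polar_commute[of u w] by simp
        qed
        then have h: "hex u = 1" "hex w = 1" "hex (u + w) = 1"
          using nonpos by (auto simp: hex_add)
        have "cross u w \<noteq> 0" "cross u (u + w) \<noteq> 0" "cross w (u + w) \<noteq> 0"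
          using uw by (simp_all add: cross_simps cross_commute[of w u])
        then have "ideal_point u \<noteq> ideal_point w" "ideal_point u \<noteq> ideal_point (u + w)"
          "ideal_point w \<noteq> ideal_point (u + w)"
          by (simp_all add: ideal_point_neq)
        then have "farey_triangle u w = {1, \<i>, -1}"
          using h[THEN hex_eq_1] unfolding farey_triangle_def by auto
        then show ?thesis
          by (simp add: farey_triangles.base)
      qed
    qed
  qed
qed

lemma farey_triangles_eq: "farey_triangles = {farey_triangle u w | u w. cross u w = 1}"
  using farey_triangles_subset farey_triangle_in_farey_triangles by blast

section \<open>Edges and vertices in terms of vectors\<close>

abbreviation edge :: "int \<times> int \<Rightarrow> int \<times> int \<Rightarrow> complex set" where
  "edge u w \<equiv> {ideal_point u, ideal_point w}"

lemma farey_edges_eq: "farey_edges = {edge u w | u w. cross u w = 1}"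
proof (intro equalityI subsetI)
  fix e assume "e \<in> farey_edges"
  then obtain a b T where "e = {a, b}" "a \<noteq> b" "T \<in> farey_triangles" "a \<in> T" "b \<in> T"
    unfolding farey_edges_def by blast
  then show "e \<in> {edge u w | u w. cross u w = 1}"
    unfolding farey_triangles_eq using farey_triangle_pair by (smt (verit) mem_Collect_eq)
next
  fix e assume "e \<in> {edge u w | u w. cross u w = 1}"
  then obtain u w where uw: "e = edge u w" "cross u w = 1"
    by blast
  then have "ideal_point u \<noteq> ideal_point w"
    by (intro ideal_point_neq) simp
  moreover have "ideal_point u \<in> farey_triangle u w" "ideal_point w \<in> farey_triangle u w"
    by (simp_all add: farey_triangle_def)
  ultimately show "e \<in> farey_edges"
    using uw farey_triangle_in_farey_triangles unfolding farey_edges_def by blast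
qed

lemma edge_in_farey_edges: "\<bar>cross u w\<bar> = 1 \<Longrightarrow> edge u w \<in> farey_edges"
proof -
  assume "\<bar>cross u w\<bar> = 1"
  then consider "cross u w = 1" | "cross w u = 1"
    by (auto simp: cross_commute[of w u] abs_if split: if_splits)
  then show ?thesis
    unfolding farey_edges_eq by cases (blast, simp only: insert_commute[of "ideal_point u"], blast)
qed

lemma farey_vertices_eq: "farey_vertices = ideal_point ` {u. primitive u}"
proof (intro equalityI subsetI)
  fix v assume "v \<in> farey_vertices"
  then obtain u w where uw: "cross u w = 1" "v \<in> farey_triangle u w"
    unfolding farey_vertices_def farey_triangles_eq by blast
  have "primitive u" "primitive w" "primitive (u + w)"
    using uw(1) primitiveI[of u w] primitiveI'[of u w] primitiveI[of "u + w" w]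
    by (simp_all add: cross_simps)
  then show "v \<in> ideal_point ` {u. primitive u}"
    using uw(2) by (auto simp: farey_triangle_def)
next
  fix v assume "v \<in> ideal_point ` {u. primitive u}"
  then obtain u w where "v = ideal_point u" "cross u w = 1"
    by (auto simp: primitive_def)
  then show "v \<in> farey_vertices"
    unfolding farey_vertices_def farey_triangles_eq
    by (intro UnionI[of "farey_triangle u w"]) (blast, simp add: farey_triangle_def)
qed

lemma edge_eqD:
  assumes uw: "\<bar>cross u w\<bar> = 1" and pq: "\<bar>cross p q\<bar> = 1" and "edge p q = edge u w"
  shows "p \<in> {u, - u} \<and> q \<in> {w, - w} \<or> p \<in> {w, - w} \<and> q \<in> {u, - u}"
proof -
  have "primitive u" "primitive w" "primitive p" "primitive q"
    using primitiveI[OF uw] primitiveI'[OF uw] primitiveI[OF pq] primitiveI'[OF pq] by simp_all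
  then have "ideal_point u = ideal_point p \<longleftrightarrow> p \<in> {u, - u}"
    "ideal_point w = ideal_point q \<longleftrightarrow> q \<in> {w, - w}"
    "ideal_point u = ideal_point q \<longleftrightarrow> q \<in> {u, - u}"
    "ideal_point w = ideal_point p \<longleftrightarrow> p \<in> {w, - w}"
    by (simp_all add: ideal_point_eq_iff)
  then show ?thesis
    using assms(3) unfolding doubleton_eq_iff by metis
qed

text \<open>Determinant 1 couples the two signs, which leaves four of the eight combinations in
  \<open>edge_eqD\<close>.\<close>

lemma oriented_edge_eqD:
  assumes uw: "cross u w = 1" and pq: "cross p q = 1" and e: "edge p q = edge u w"
  shows "(p, q) \<in> {(u, w), (- u, - w), (w, - u), (- w, u)}"
proof -
  have "p \<in> {u, - u} \<and> q \<in> {w, - w} \<or> p \<in> {w, - w} \<and> q \<in> {u, - u}"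
    using assms by (intro edge_eqD) auto
  then show ?thesis
    using uw pq by (auto simp: cross_simps cross_commute[of w u])
qed

text \<open>Up to sign an edge has the two oriented bases \<open>(u, w)\<close> and
  \<open>(w, - u)\<close>, and each determines one triangle.\<close>

lemma farey_triangle_on_edge:
  assumes uw: "cross u w = 1" and T: "T \<in> farey_triangles"
    and "ideal_point u \<in> T" "ideal_point w \<in> T"
  shows "T = farey_triangle u w \<or> T = farey_triangle w (- u)"
proof -
  obtain r s where rs: "cross r s = 1" "T = farey_triangle r s"
    using T unfolding farey_triangles_eq by blast
  have "ideal_point u \<noteq> ideal_point w"
    using uw by (intro ideal_point_neq) simp
  then obtain p q where pq: "cross p q = 1" "farey_triangle p q = T" "edge u w = edge p q"
    using farey_triangle_pair[of r s "ideal_point u" "ideal_point w"] rs assms(3,4) by metis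
  have "(p, q) \<in> {(u, w), (- u, - w), (w, - u), (- w, u)}"
    using pq uw by (intro oriented_edge_eqD) auto
  then show ?thesis
    using pq(2) farey_triangle_minus[of u w] farey_triangle_minus[of w "- u"] by auto
qed

subsection \<open>Quads\<close>

text \<open>Twice the signed area of the Euclidean triangle; it separates the two sides of a chord
  without choosing angles.\<close>

definition orientation :: "complex \<Rightarrow> complex \<Rightarrow> complex \<Rightarrow> real" where
  "orientation a b c = Im (cnj (b - a) * (c - a))"

lemma orientation_swap: "orientation c b a = - orientation a b c"
  by (simp add: orientation_def algebra_simps)

lemma orientation_degenerate [simp]: "orientation a a c = 0" "orientation a c c = 0"
  "orientation a c a = 0"
  by (simp_all add: orientation_def algebra_simps)

text \<open>With \<open>x\<close> and \<open>y\<close> half the arcs between consecutive points, the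
  left side is the \<open>orientation\<close> of three points on the circle; the product form shows
  its sign.\<close>

lemma sin_add_sin_minus_sin_add:
  fixes x y :: real
  shows "sin (2 * x) + sin (2 * y) - sin (2 * (x + y)) = 4 * sin x * sin y * sin (x + y)"
proof -
  have "sin x ^ 2 + cos x ^ 2 = 1" "sin y ^ 2 + cos y ^ 2 = 1"
    by simp_all
  then show ?thesis
    unfolding sin_double sin_add cos_add by algebra
qed

lemma orientation_cis_pos:
  assumes "\<alpha> < \<beta>" "\<beta> < \<gamma>" "\<gamma> < \<alpha> + 2 * pi"
  shows "orientation (cis \<alpha>) (cis \<beta>) (cis \<gamma>) > 0"
proof -
  define x y where "x = (\<beta> - \<alpha>) / 2" "y = (\<gamma> - \<beta>) / 2"
  have "orientation (cis \<alpha>) (cis \<beta>) (cis \<gamma>) = sin (2 * x) + sin (2 * y) - sin (2 * (x + y))"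
    unfolding orientation_def x_y_def
    by (simp add: sin_diff algebra_simps add_divide_distrib diff_divide_distrib)
  also have "\<dots> = 4 * sin x * sin y * sin (x + y)"
    by (rule sin_add_sin_minus_sin_add)
  also have "\<dots> > 0"
    using assms by (intro mult_pos_pos sin_gt_zero) (simp_all add: x_y_def field_simps)
  finally show ?thesis .
qed

lemma ccw_on_circle_orientation:
  assumes "ccw_on_circle a b c d"
  shows "orientation a b c > 0" "orientation c d a > 0"
proof -
  obtain \<alpha> \<beta> \<gamma> \<delta> where o: "\<alpha> < \<beta>" "\<beta> < \<gamma>" "\<gamma> < \<delta>" "\<delta> < \<alpha> + 2 * pi"
    and eq: "a = cis \<alpha>" "b = cis \<beta>" "c = cis \<gamma>" "d = cis \<delta>"
    using assms unfolding ccw_on_circle_def by blast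
  show "orientation a b c > 0"
    using o unfolding eq by (intro orientation_cis_pos) auto
  have "cis (\<alpha> + 2 * pi) = cis \<alpha>"
    by (simp flip: cis_mult)
  then show "orientation c d a > 0"
    using o orientation_cis_pos[of \<gamma> \<delta> "\<alpha> + 2 * pi"] unfolding eq by simp
qed

text \<open>Positive determinants order the directions within an open half turn starting at
  \<open>a\<close>. Since \<open>ideal_point\<close> doubles angles, the points follow each other
  within one full turn.\<close>

lemma ccw_ideal_points:
  assumes pos: "cross a b > 0" "cross a c > 0" "cross a d > 0" "cross b c > 0" "cross b d > 0"
    "cross c d > 0"
  shows "ccw_on_circle (ideal_point a) (ideal_point b) (ideal_point c) (ideal_point d)"
proof -
  \<comment> \<open>The angle of a vector measured from \<open>a\<close>, so that \<open>a\<close>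
    itself gets angle 0 and the branch cut of \<open>Arg\<close> stays out of the way.\<close>
  define \<phi> where "\<phi> u = Arg (gauss u / gauss a)" for u
  define \<alpha> where "\<alpha> = Arg (gauss a)"
  have a0: "gauss a \<noteq> 0"
    using cross_neq_0_imp(1)[of a b] pos(1) by (simp add: gauss_eq_0_iff)
  have polar: "gauss u = of_real (norm (gauss u)) * cis (\<alpha> + \<phi> u)" for u
  proof -
    have "gauss u = gauss a * (gauss u / gauss a)"
      using a0 by simp
    also have "\<dots> = rcis (norm (gauss a)) \<alpha> * rcis (norm (gauss u / gauss a)) (\<phi> u)"
      unfolding \<phi>_def \<alpha>_def rcis_cmod_Arg ..
    also have "\<dots> = rcis (norm (gauss u)) (\<alpha> + \<phi> u)"
      using a0 by (simp add: rcis_mult norm_divide)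
    finally show ?thesis
      by (simp add: rcis_def)
  qed
  have cross_sin: "of_int (cross u w) = norm (gauss u) * norm (gauss w) * sin (\<phi> w - \<phi> u)" for u w
  proof -
    have "cnj (gauss u) * gauss w =
        of_real (norm (gauss u) * norm (gauss w)) * (cis (- (\<alpha> + \<phi> u)) * cis (\<alpha> + \<phi> w))"
      by (subst polar[of u], subst polar[of w]) (simp add: cis_cnj)
    also have "cis (- (\<alpha> + \<phi> u)) * cis (\<alpha> + \<phi> w) = cis (\<phi> w - \<phi> u)"
      by (simp add: cis_mult)
    finally show ?thesis
      by (simp flip: Im_cnj_gauss_mult)
  qed
  have sin_pos: "sin (\<phi> w - \<phi> u) > 0" if "cross u w > 0" for u w
    using that cross_sin[of u w]
    by (smt (verit) mult_nonneg_nonpos mult_nonneg_nonneg norm_ge_zero of_int_0_less_iff)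
  have \<phi>a: "\<phi> a = 0"
    unfolding \<phi>_def using a0 by (intro cis_Arg_unique) simp_all
  have range: "- pi < \<phi> u" "\<phi> u \<le> pi" for u
    unfolding \<phi>_def using Arg_bounded by auto
  have gt0: "\<phi> u > 0" "\<phi> u < pi" if "cross a u > 0" for u
  proof -
    have s: "sin (\<phi> u) > 0"
      using sin_pos[OF that] \<phi>a by simp
    show "\<phi> u > 0"
      using s range[of u] sin_ge_zero[of "- \<phi> u"] by (cases "\<phi> u > 0") auto
    show "\<phi> u < pi"
      using s range[of u] by (cases "\<phi> u = pi") auto
  qed
  have less: "\<phi> u < \<phi> w" if "cross a u > 0" "cross a w > 0" "cross u w > 0" for u w
  proof (rule ccontr)
    assume "\<not> \<phi> u < \<phi> w"
    then have "sin (\<phi> u - \<phi> w) \<ge> 0"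
      using gt0[OF that(1)] gt0[OF that(2)] by (intro sin_ge_zero) auto
    then show False
      using sin_pos[OF that(3)] sin_minus[of "\<phi> u - \<phi> w"] by simp
  qed
  have V: "ideal_point u = cis (2 * (\<alpha> + \<phi> u))" if "u \<noteq> 0" for u
  proof -
    have "norm (gauss u) \<noteq> 0"
      using that by (simp add: gauss_eq_0_iff)
    then have "ideal_point u = cis (\<alpha> + \<phi> u) / cis (- (\<alpha> + \<phi> u))"
      unfolding ideal_point_def by (subst (1 2) polar) (simp add: cis_cnj)
    then show ?thesis
      by (simp add: cis_divide)
  qed
  have nz: "a \<noteq> 0" "b \<noteq> 0" "c \<noteq> 0" "d \<noteq> 0"
    using pos by auto
  show ?thesis
    unfolding ccw_on_circle_def
    using gt0[OF pos(1)] gt0[OF pos(3)] less[OF pos(1,2,4)] less[OF pos(2,3,6)]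
    by (intro exI[of _ "2 * (\<alpha> + \<phi> a)"] exI[of _ "2 * (\<alpha> + \<phi> b)"] exI[of _ "2 * (\<alpha> + \<phi> c)"]
        exI[of _ "2 * (\<alpha> + \<phi> d)"]) (simp add: V nz \<phi>a)
qed

section \<open>The quad around an edge\<close>

lemma farey_quad_ideal_points:
  assumes uw: "cross u w = 1"
  shows "farey_quad (ideal_point u) (ideal_point (u + w)) (ideal_point w) (ideal_point (w - u))"
proof -
  have "cross w (- u) = 1"
    using uw by (simp add: cross_minus_right cross_commute[of w u])
  then have "farey_triangle u w \<in> farey_triangles" "farey_triangle w (- u) \<in> farey_triangles"
    using uw farey_triangle_in_farey_triangles by blast+
  moreover have "ccw_on_circle (ideal_point u) (ideal_point (u + w)) (ideal_point w) (ideal_point (w - u))"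
    using uw by (intro ccw_ideal_points) (simp_all add: cross_simps cross_commute[of w u])
  ultimately show ?thesis
    by (simp add: farey_quad_def farey_triangle_def insert_commute)
qed

text \<open>Only two triangles contain the edge, so \<open>b\<close> and \<open>d\<close> are each
  one of two points; the sign of \<open>orientation\<close> selects the right one.\<close>

lemma farey_quadD:
  assumes uw: "cross u w = 1" and q: "farey_quad (ideal_point u) b (ideal_point w) d"
  shows "b = ideal_point (u + w)" "d = ideal_point (w - u)"
proof -
  let ?a = "ideal_point u" and ?c = "ideal_point w"
    and ?m = "ideal_point (u + w)" and ?n = "ideal_point (w - u)"
  have q': "orientation ?a b ?c > 0" "orientation ?c d ?a > 0"
    using q ccw_on_circle_orientation unfolding farey_quad_def by blast+
  have o: "orientation ?a ?m ?c > 0" "orientation ?c ?n ?a > 0"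
    using farey_quad_ideal_points[OF uw] ccw_on_circle_orientation unfolding farey_quad_def by blast+
  have T: "x = ?m \<or> x = ?n" if "{?a, ?c, x} \<in> farey_triangles" "x \<noteq> ?a" "x \<noteq> ?c" for x
    using farey_triangle_on_edge[OF uw that(1)] that(2,3) ideal_point_diff_commute[of u w]
    unfolding farey_triangle_opposite farey_triangle_def by auto
  have "{?a, b, ?c} = {?a, ?c, b}" "{?c, d, ?a} = {?a, ?c, d}"
    by auto
  then have "{?a, ?c, b} \<in> farey_triangles" "{?a, ?c, d} \<in> farey_triangles"
    using q unfolding farey_quad_def by simp_all
  moreover have "b \<noteq> ?a" "b \<noteq> ?c" "d \<noteq> ?a" "d \<noteq> ?c"
    using q' by auto
  ultimately have "b = ?m \<or> b = ?n" "d = ?m \<or> d = ?n"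
    using T by blast+
  then show "b = ?m" "d = ?n"
    using q' o orientation_swap[of ?c ?n ?a] orientation_swap[of ?a ?m ?c] by auto
qed

lemma Phi_edge:
  assumes uw: "cross u w = 1"
  shows "Phi \<theta> (edge u w) =
    - \<theta> (edge u (u + w)) + \<theta> (edge (u + w) w) - \<theta> (edge w (w - u)) + \<theta> (edge (w - u) u)"
proof -
  let ?v = "- \<theta> (edge u (u + w)) + \<theta> (edge (u + w) w) - \<theta> (edge w (w - u)) + \<theta> (edge (w - u) u)"
  have wu: "cross w (- u) = 1"
    using uw by (simp add: cross_minus_right cross_commute[of w u])
  have "edge u w \<in> farey_edges"
    using uw by (intro edge_in_farey_edges) simp
  moreover have "(THE x. \<exists>a b c d. edge u w = {a, c} \<and> farey_quad a b c d \<and>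
     x = - \<theta> {a, b} + \<theta> {b, c} - \<theta> {c, d} + \<theta> {d, a}) = ?v"
  proof (rule the_equality)
    show "\<exists>a b c d. edge u w = {a, c} \<and> farey_quad a b c d \<and>
        ?v = - \<theta> {a, b} + \<theta> {b, c} - \<theta> {c, d} + \<theta> {d, a}"
      using farey_quad_ideal_points[OF uw] by blast
  next
    fix x assume "\<exists>a b c d. edge u w = {a, c} \<and> farey_quad a b c d \<and>
        x = - \<theta> {a, b} + \<theta> {b, c} - \<theta> {c, d} + \<theta> {d, a}"
    then obtain a b c d where e: "edge u w = {a, c}" and q: "farey_quad a b c d"
      and x: "x = - \<theta> {a, b} + \<theta> {b, c} - \<theta> {c, d} + \<theta> {d, a}"
      by blast
    \<comment> \<open>Writing \<open>ideal_point (- u)\<close> makes the second labelling an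
      instance of \<open>farey_quadD\<close> for the basis \<open>(w, - u)\<close>.\<close>
    consider "a = ideal_point u" "c = ideal_point w" | "a = ideal_point w" "c = ideal_point (- u)"
      using e by (auto simp: doubleton_eq_iff)
    then show "x = ?v"
    proof cases
      case 1
      then show ?thesis
        using farey_quadD[OF uw] q x by auto
    next
      case 2
      then have "b = ideal_point (w + - u)" "d = ideal_point (- u - w)"
        using farey_quadD[OF wu] q by simp_all
      moreover have "ideal_point (- u - w) = ideal_point (u + w)"
        using ideal_point_minus[of "u + w"] by simp
      ultimately show ?thesis
        using 2 x by (simp add: insert_commute)
    qed
  qed
  ultimately show ?thesis
    by (simp add: Phi_def)
qed

subsection \<open>Depth and uniqueness\<close>

text \<open>At a Farey vertex the choice is between a vector and its negative, which
  \<open>hex\<close> does not distinguish.\<close>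

definition hex_at :: "complex \<Rightarrow> int" where
  "hex_at z = hex (SOME u. primitive u \<and> ideal_point u = z)"

text \<open>A natural number, so that it can serve as an exponent in the weight of the existence
  induction.\<close>

definition depth :: "complex set \<Rightarrow> nat" where
  "depth e = nat (Max (hex_at ` e))"

lemma hex_at_ideal_point: "primitive u \<Longrightarrow> hex_at (ideal_point u) = hex u"
proof -
  assume u: "primitive u"
  let ?u = "SOME u'. primitive u' \<and> ideal_point u' = ideal_point u"
  have "primitive ?u \<and> ideal_point ?u = ideal_point u"
    by (rule someI[of _ u]) (simp add: u)
  then have "?u = u \<or> ?u = - u"
    using ideal_point_eq_iff[OF u, of ?u] by simp
  then show ?thesis
    unfolding hex_at_def by (metis hex_minus)
qed

lemma depth_edge: "\<bar>cross u w\<bar> = 1 \<Longrightarrow> depth (edge u w) = nat (max (hex u) (hex w))"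
  by (simp add: depth_def hex_at_ideal_point primitiveI primitiveI')

text \<open>Passing from \<open>(u, w)\<close> to \<open>(w, - u)\<close> negates the polar form,
  which is never 0; exactly one of these bases therefore has its sum on the outer side.\<close>

lemma farey_edge_acute:
  assumes "e \<in> farey_edges"
  obtains u w where "cross u w = 1" "hex_polar u w > 0" "e = edge u w"
proof -
  obtain u w where uw: "cross u w = 1" "e = edge u w"
    using assms unfolding farey_edges_eq by blast
  have "hex_polar u w \<noteq> 0"
    using hex_polar_odd[of u w] uw by auto
  then consider "hex_polar u w > 0" | "hex_polar w (- u) > 0"
    using that by (simp add: hex_polar_simps hex_polar_commute[of w u]) linarith
  then show thesis
  proof cases
    case 1
    then show ?thesis using uw that by blast
  next
    case 2
    then show ?thesis
      using uw by (intro that[of w "- u"])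
        (auto simp: cross_simps cross_commute[of w u])
  qed
qed

lemma hex_outer:
  assumes "\<bar>cross u w\<bar> = 1" "hex_polar u w > 0"
  shows "hex u < hex (u + w)" "hex w < hex (u + w)"
  using assms(2) abs_cross_1_imp(3,4)[OF assms(1)] by (simp_all add: hex_add)

text \<open>The claim amounts to \<open>min (hex u) (hex w) \<le> hex_polar u w\<close>. A smaller
  polar form would make the pair reduced, with both values of \<open>hex\<close> equal to 1, and
  then a positive integer cannot lie below the minimum.\<close>

lemma hex_inner:
  assumes "\<bar>cross u w\<bar> = 1" "hex_polar u w > 0"
  shows "hex (w - u) \<le> max (hex u) (hex w)"
proof -
  have "min (hex u) (hex w) \<le> hex_polar u w"
  proof (rule ccontr)
    assume *: "\<not> min (hex u) (hex w) \<le> hex_polar u w"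
    have "hex_polar w u = hex_polar u w" "\<bar>cross w u\<bar> = 1"
      using assms(1) by (simp_all add: hex_polar_commute[of u w] cross_commute[of w u])
    with * have "hex u = 1 \<and> hex w = 1"
      using hex_eq_1_if_short[OF assms(1)] hex_eq_1_if_short[of w u] assms(2)
      by (cases "hex u \<le> hex w") auto
    then show False
      using * assms(2) by simp
  qed
  then show ?thesis
    using hex_polar_commute[of w u] by (auto simp: hex_diff)
qed

text \<open>Triviality of the kernel on finitely supported functions; applied to a difference, it
  gives uniqueness.\<close>

lemma Phi_zero:
  assumes fin: "finite (support \<theta>)" and zero: "\<And>e. e \<in> farey_edges \<Longrightarrow> Phi \<theta> e = 0"
  shows "support \<theta> = {}"
proof (rule ccontr)
  assume ne: "support \<theta> \<noteq> {}"
  define N where "N = Max (depth ` support \<theta>)"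
  have "N \<in> depth ` support \<theta>"
    unfolding N_def using fin ne by (intro Max_in) auto
  then obtain e where e: "e \<in> support \<theta>" "depth e = N"
    by blast
  then have "e \<in> farey_edges" "\<theta> e \<noteq> 0"
    by (simp_all add: support_def)
  then obtain u w where uw: "cross u w = 1" "hex_polar u w > 0" "e = edge u w"
    by (elim farey_edge_acute)
  \<comment> \<open>An edge with an end at least as large as \<open>u + w\<close> is deeper than
    \<open>e\<close>, whose depth is maximal in the support.\<close>
  have deep: "\<theta> (edge p q) = 0" if "\<bar>cross p q\<bar> = 1" "hex (u + w) \<le> max (hex p) (hex q)" for p q
  proof (rule ccontr)
    assume "\<theta> (edge p q) \<noteq> 0"
    then have "edge p q \<in> support \<theta>"
      using that by (simp add: support_def edge_in_farey_edges)
    then have "depth (edge p q) \<le> N"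
      unfolding N_def using fin by simp
    then have "max (hex p) (hex q) \<le> max (hex u) (hex w)"
      using e(2) uw that(1) abs_cross_1_imp(3)[of u w] by (auto simp: depth_edge nat_le_eq_zle)
    then show False
      using that(2) hex_outer[of u w] uw by (auto simp: le_max_iff_disj)
  qed
  have "hex (u + w) \<le> hex (u + (u + w))"
    using uw abs_cross_1_imp(3)[of u w] by (simp add: hex_add[of u "u + w"] hex_polar_simps)
  then have "\<theta> (edge u (u + (u + w))) = 0" "\<theta> (edge (u + (u + w)) (u + w)) = 0"
    "\<theta> (edge (u + w) w) = 0"
    using uw by (auto intro!: deep simp: cross_simps cross_commute[of w u])
  moreover have "cross u (u + w) = 1"
    using uw by (simp add: cross_simps)
  \<comment> \<open>The quad around \<open>edge u (u + w)\<close> has outer vertex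
    \<open>u + (u + w)\<close> and inner vertex \<open>w\<close>; of its four sides only
    \<open>edge w u\<close> escapes \<open>deep\<close>.\<close>
  then have "Phi \<theta> (edge u (u + w)) = - \<theta> (edge u (u + (u + w))) +
      \<theta> (edge (u + (u + w)) (u + w)) - \<theta> (edge (u + w) w) + \<theta> (edge w u)"
    using Phi_edge[of u "u + w" \<theta>] by simp
  moreover have "Phi \<theta> (edge u (u + w)) = 0"
    using \<open>cross u (u + w) = 1\<close> by (intro zero edge_in_farey_edges) simp
  ultimately have "\<theta> (edge w u) = 0"
    by simp
  then show False
    using \<open>\<theta> e \<noteq> 0\<close> uw(3) by (simp add: insert_commute)
qed

text \<open>This shape of linearity serves for adding a multiple of an indicator, for differences
  (\<open>t = - 1\<close>) and for the value at the zero function.\<close>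

lemma Phi_add_mult:
  assumes "e \<in> farey_edges"
  shows "Phi (\<lambda>f. \<theta> f + t * \<eta> f) e = Phi \<theta> e + t * Phi \<eta> e"
  using assms unfolding farey_edges_eq by (auto simp: Phi_edge algebra_simps)

text \<open>The sides of every quad are themselves edges, so a solution may be made extensional
  without changing its image.\<close>

lemma Phi_restrict: "Phi (restrict \<theta> farey_edges) = Phi \<theta>"
proof
  fix e
  show "Phi (restrict \<theta> farey_edges) e = Phi \<theta> e"
  proof (cases "e \<in> farey_edges")
    case True
    then obtain u w where uw: "cross u w = 1" "e = edge u w"
      unfolding farey_edges_eq by blast
    have "edge u (u + w) \<in> farey_edges" "edge (u + w) w \<in> farey_edges"
      "edge w (w - u) \<in> farey_edges" "edge (w - u) u \<in> farey_edges"
      using uw by (auto intro!: edge_in_farey_edges simp: cross_simps cross_commute[of w u])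
    then show ?thesis
      using uw by (simp add: Phi_edge)
  next
    case False
    then show ?thesis
      by (simp add: Phi_def)
  qed
qed

subsection \<open>Existence\<close>

text \<open>The column of \<open>Phi\<close> at \<open>edge u w\<close>. Its signs are opposite to
  those of the row in \<open>Phi_edge\<close>: the matrix of \<open>Phi\<close> is
  antisymmetric.\<close>

definition quad_shear :: "int \<times> int \<Rightarrow> int \<times> int \<Rightarrow> complex set \<Rightarrow> real" where
  "quad_shear u w f = of_bool (f = edge u (u + w)) - of_bool (f = edge (u + w) w) +
     of_bool (f = edge w (w - u)) - of_bool (f = edge (w - u) u)"

definition eq_up_to_sign :: "(int \<times> int) \<times> (int \<times> int) \<Rightarrow> (int \<times> int) \<times> (int \<times> int) \<Rightarrow> bool" where
  "eq_up_to_sign P R \<longleftrightarrow> P = R \<or> P = - R"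

text \<open>An edge carries exactly two unimodular bases up to sign, one for each of its orientations.\<close>
lemma of_bool_edge_eq:
  assumes "cross u w = 1" "cross p q = 1"
  shows "of_bool (edge p q = edge u w) =
    (of_bool (eq_up_to_sign (p, q) (u, w)) + of_bool (eq_up_to_sign (p, q) (w, - u)) :: real)"
proof -
  have iff: "edge p q = edge u w \<longleftrightarrow> eq_up_to_sign (p, q) (u, w) \<or> eq_up_to_sign (p, q) (w, - u)"
  proof
    assume "edge p q = edge u w"
    then show "eq_up_to_sign (p, q) (u, w) \<or> eq_up_to_sign (p, q) (w, - u)"
      using oriented_edge_eqD[OF assms] by (auto simp: eq_up_to_sign_def)
  next
    assume "eq_up_to_sign (p, q) (u, w) \<or> eq_up_to_sign (p, q) (w, - u)"
    then show "edge p q = edge u w"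
      by (auto simp: eq_up_to_sign_def)
  qed
  have "\<not> (eq_up_to_sign (p, q) (u, w) \<and> eq_up_to_sign (p, q) (w, - u))"
  proof
    assume "eq_up_to_sign (p, q) (u, w) \<and> eq_up_to_sign (p, q) (w, - u)"
    then have "w = u \<or> w = - u"
      by (auto simp: eq_up_to_sign_def)
    then show False
      using assms(1) by (auto simp: cross_simps)
  qed
  then show ?thesis
    unfolding iff by auto
qed

text \<open>Each side becomes a signed sum of eight coincidences between bases up to sign, and these
  agree term by term.\<close>

lemma Phi_of_bool:
  assumes uw: "cross u w = 1" and f: "f \<in> farey_edges"
  shows "Phi (\<lambda>f. of_bool (f = edge u w)) f = quad_shear u w f"
proof -
  obtain p q where pq: "cross p q = 1" "f = edge p q"
    using f unfolding farey_edges_eq by blast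
  have com: "cross w u = - 1" "cross q p = - 1"
    using uw pq(1) by (simp_all add: cross_commute[of w u] cross_commute[of q p])
  have c: "cross p (p + q) = 1" "cross (p + q) q = 1" "cross q (q - p) = 1" "cross p (q - p) = 1"
    "cross u (u + w) = 1" "cross (u + w) w = 1" "cross w (w - u) = 1" "cross u (w - u) = 1"
    using uw pq com by (simp_all add: cross_simps)
  have swap: "edge (q - p) p = edge p (q - p)" "edge (w - u) u = edge u (w - u)"
    by (simp_all add: insert_commute)
  \<comment> \<open>Each coincidence is solved for \<open>(p, q)\<close>; for instance
    \<open>(p, p + q) = (u, w)\<close> means \<open>(p, q) = (u, w - u)\<close>.\<close>
  have match:
    "eq_up_to_sign (p, p + q) (u, w) = eq_up_to_sign (p, q) (u, w - u)"
    "eq_up_to_sign (p, p + q) (w, - u) = eq_up_to_sign (p, q) (w, - (u + w))"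
    "eq_up_to_sign (q, q - p) (u, w) = eq_up_to_sign (p, q) (w - u, - u)"
    "eq_up_to_sign (q, q - p) (w, - u) = eq_up_to_sign (p, q) (u + w, w)"
    "eq_up_to_sign (p + q, q) (u, w) = eq_up_to_sign (p, q) (w - u, - w)"
    "eq_up_to_sign (p + q, q) (w, - u) = eq_up_to_sign (p, q) (u + w, - u)"
    "eq_up_to_sign (p, q - p) (u, w) = eq_up_to_sign (p, q) (u, u + w)"
    "eq_up_to_sign (p, q - p) (w, - u) = eq_up_to_sign (p, q) (w, w - u)"
    by (auto simp: eq_up_to_sign_def prod_eq_iff)
  show ?thesis
    unfolding pq(2) Phi_edge[OF pq(1)] quad_shear_def swap
      of_bool_edge_eq[OF uw c(1)] of_bool_edge_eq[OF uw c(2)] of_bool_edge_eq[OF uw c(3)]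
      of_bool_edge_eq[OF uw c(4)]
      of_bool_edge_eq[OF c(5) pq(1)] of_bool_edge_eq[OF c(6) pq(1)] of_bool_edge_eq[OF c(7) pq(1)]
      of_bool_edge_eq[OF c(8) pq(1)] match
    by (auto simp: eq_up_to_sign_def)
qed

text \<open>Summing over one fixed finite set with an incidence factor makes the condition visibly
  linear in \<open>s\<close>.\<close>

lemma finite_balanced_iff:
  assumes fin: "finite S" and S: "support s \<subseteq> S" "S \<subseteq> farey_edges"
  shows "finite_balanced s \<longleftrightarrow> (\<forall>v\<in>farey_vertices. (\<Sum>e\<in>S. of_bool (v \<in> e) * s e) = 0)"
proof -
  have eq: "{e \<in> fan v. s e \<noteq> 0} = {e \<in> support s. v \<in> e}" for v
    by (auto simp: fan_def support_def)
  have "(\<Sum>e\<in>S. of_bool (v \<in> e) * s e) = (\<Sum>e | e \<in> fan v \<and> s e \<noteq> 0. s e)" for v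
  proof -
    have "(\<Sum>e | e \<in> fan v \<and> s e \<noteq> 0. s e) = (\<Sum>e | e \<in> fan v \<and> s e \<noteq> 0. of_bool (v \<in> e) * s e)"
      by (intro sum.cong) (auto simp: fan_def)
    also have "\<dots> = (\<Sum>e\<in>S. of_bool (v \<in> e) * s e)"
      using S by (intro sum.mono_neutral_left fin) (auto simp: fan_def support_def)
    finally show ?thesis ..
  qed
  moreover have "finite {e \<in> fan v. s e \<noteq> 0}" for v
    unfolding eq using finite_subset[OF S(1) fin] by simp
  ultimately show ?thesis
    by (simp add: finite_balanced_def)
qed

section \<open>Balance of the image of an indicator\<close>

lemma quad_vertices_distinct:
  assumes "cross u w = 1"
  shows "distinct [ideal_point u, ideal_point (u + w), ideal_point w, ideal_point (w - u)]"
  using assms by (auto intro!: ideal_point_neq simp: cross_simps cross_commute[of w u])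

lemma quad_edges_in_farey_edges:
  assumes "cross u w = 1"
  shows "{edge u (u + w), edge (u + w) w, edge w (w - u), edge (w - u) u} \<subseteq> farey_edges"
  using assms by (auto intro!: edge_in_farey_edges simp: cross_simps cross_commute[of w u])

text \<open>At each vertex of the quad two consecutive sides meet, and they carry opposite signs in
  \<open>quad_shear\<close>.\<close>

lemma finite_balanced_diff_quad_shear:
  assumes uw: "cross u w = 1" and fin: "finite (support s)" and bal: "finite_balanced s"
  shows "finite_balanced (\<lambda>f. s f - t * quad_shear u w f)"
proof -
  let ?E = "{edge u (u + w), edge (u + w) w, edge w (w - u), edge (w - u) u}"
  define S where "S = support s \<union> ?E"
  have S: "finite S" "S \<subseteq> farey_edges" "support s \<subseteq> S"
    using fin quad_edges_in_farey_edges[OF uw] by (auto simp: S_def support_def)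
  have delta: "(\<Sum>f\<in>S. of_bool (v \<in> f) * of_bool (f = e)) = (of_bool (v \<in> e) :: real)"
    if "e \<in> S" for v :: complex and e
  proof -
    have "(\<Sum>f\<in>S. of_bool (v \<in> f) * of_bool (f = e)) =
        (\<Sum>f\<in>S. if f = e then of_bool (v \<in> f) else (0 :: real))"
      by (intro sum.cong) auto
    then show ?thesis
      using S(1) that by simp
  qed
  have zero: "(\<Sum>f\<in>S. of_bool (v \<in> f) * quad_shear u w f) = 0" for v :: complex
  proof -
    have "(\<Sum>f\<in>S. of_bool (v \<in> f) * quad_shear u w f) =
        of_bool (v \<in> edge u (u + w)) - of_bool (v \<in> edge (u + w) w) +
        of_bool (v \<in> edge w (w - u)) - of_bool (v \<in> edge (w - u) u)"
      unfolding quad_shear_def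
      by (simp only: distrib_left right_diff_distrib sum.distrib sum_subtractf)
        ((subst delta, simp add: S_def)+, rule refl)
    also have "\<dots> = 0"
      using quad_vertices_distinct[OF uw] by auto
    finally show ?thesis .
  qed
  have bal': "(\<Sum>e\<in>S. of_bool (v \<in> e) * s e) = 0" if "v \<in> farey_vertices" for v
    using bal finite_balanced_iff[OF S(1,3,2)] that by blast
  have "(\<Sum>f\<in>S. of_bool (v \<in> f) * (s f - t * quad_shear u w f)) =
      (\<Sum>f\<in>S. of_bool (v \<in> f) * s f) - t * (\<Sum>f\<in>S. of_bool (v \<in> f) * quad_shear u w f)" for v
    by (simp add: algebra_simps sum_subtractf sum_distrib_left)
  moreover have "support (\<lambda>f. s f - t * quad_shear u w f) \<subseteq> S"
    by (auto simp: S_def support_def quad_shear_def)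
  ultimately show ?thesis
    using finite_balanced_iff[OF S(1) _ S(2)] bal' zero by simp
qed

text \<open>One step of Gauss reduction: subtracting the shorter vector from the longer one keeps
  the polar form positive, since otherwise the pair would be reduced and the depth 1.\<close>

lemma farey_edge_parent:
  assumes "e \<in> farey_edges" "depth e > 1"
  obtains u w where "cross u w = 1" "hex_polar u w > 0" "e \<in> {edge u (u + w), edge (u + w) w}"
proof -
  obtain p q where pq: "cross p q = 1" "hex_polar p q > 0" "e = edge p q"
    using assms(1) by (rule farey_edge_acute)
  have a: "\<bar>cross p q\<bar> = 1" "\<bar>cross q p\<bar> = 1"
    using pq by (simp_all add: cross_commute[of q p])
  have d: "max (hex p) (hex q) > 1"
    using assms(2) pq(3) depth_edge[OF a(1)] by simp
  have odd: "hex_polar p q \<noteq> 2 * hex p" "hex_polar p q \<noteq> 2 * hex q"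
    using hex_polar_odd[OF a(1)] by auto
  have com: "hex_polar q p = hex_polar p q"
    by (rule hex_polar_commute)
  show thesis
  proof (cases "hex p \<le> hex q")
    case True
    then have "hex_polar p (q - p) > 0"
      using hex_eq_1_if_short(2)[OF a(1)] odd(1) pq(2) d
      by (cases "hex_polar p q < 2 * hex p") (auto simp: hex_polar_simps)
    then show ?thesis
      using that[of p "q - p"] pq by (simp add: cross_simps)
  next
    case False
    then have "hex_polar (p - q) q > 0"
      using hex_eq_1_if_short(2)[OF a(2)] odd(2) pq(2) d com
      by (cases "hex_polar p q < 2 * hex q") (auto simp: hex_polar_simps)
    then show ?thesis
      using that[of "p - q" q] pq by (simp add: cross_simps)
  qed
qed

text \<open>Up to sign the neighbours of \<open>m = u + w\<close> are \<open>k * m - u\<close> for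
  integers \<open>k\<close>. Their \<open>hex\<close> is a convex quadratic in \<open>k\<close> that
  exceeds \<open>hex m\<close> except at \<open>k = 0\<close> and \<open>k = 1\<close>, where the
  neighbours are \<open>- u\<close> and \<open>w\<close>.\<close>

lemma shallow_edges_at_outer_vertex:
  assumes uw: "cross u w = 1" "hex_polar u w > 0"
    and e: "e \<in> farey_edges" "ideal_point (u + w) \<in> e" "depth e \<le> nat (hex (u + w))"
  shows "e \<in> {edge u (u + w), edge (u + w) w}"
proof -
  define m where "m = u + w"
  have pm: "primitive m"
    using uw by (intro primitiveI[of _ w]) (simp add: m_def cross_simps)
  obtain y where y: "cross m y = 1" "e = edge m y"
  proof -
    obtain p q where pq: "cross p q = 1" "e = edge p q"
      using e(1) unfolding farey_edges_eq by blast
    have pr: "primitive p" "primitive q"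
      using pq primitiveI[of p q] primitiveI'[of p q] by simp_all
    have com: "cross q p = - 1"
      using pq(1) by (simp add: cross_commute[of q p])
    have "ideal_point m = ideal_point p \<or> ideal_point m = ideal_point q"
      using e(2) pq(2) by (simp add: m_def)
    then consider "p = m" | "p = - m" | "q = m" | "q = - m"
      using ideal_point_eq_iff[OF pm pr(1)] ideal_point_eq_iff[OF pm pr(2)] by blast
    then show thesis
      using pq com by cases (auto intro: that[of q] that[of "- q"] that[of "- p"] that[of p]
          simp: cross_simps insert_commute)
  qed
  have "\<bar>cross m y\<bar> = 1"
    using y by simp
  then have hy: "hex y \<le> hex m"
    using e(3) hex_nonneg[of m] unfolding y(2) m_def[symmetric] by (simp add: depth_edge nat_le_eq_zle)
  define k where "k = cross u y"
  have um: "cross u m = 1"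
    using uw by (simp add: m_def cross_simps)
  \<comment> \<open>Cramer's rule for \<open>y\<close> in the basis \<open>u\<close>,
    \<open>m\<close>.\<close>
  have "fst y * cross u m = cross u y * fst m - cross m y * fst u"
    "snd y * cross u m = cross u y * snd m - cross m y * snd u"
    by (simp_all add: cross_def algebra_simps)
  then have yk: "fst y = k * fst m - fst u" "snd y = k * snd m - snd u"
    using y um by (simp_all add: k_def)
  define \<beta> where "\<beta> = hex_polar u m"
  have hyk: "hex y = hex u - k * \<beta> + k * k * hex m"
    unfolding hex_def yk \<beta>_def hex_polar_def by (simp add: algebra_simps)
  have pos: "hex u > 0" "hex w > 0" "hex m > 0"
    using uw abs_cross_1_imp(3,4)[of u w] pm hex_pos primitive_nonzero by simp_all
  have \<beta>: "\<beta> = 2 * hex u + hex_polar u w" "hex m = hex u + hex w + hex_polar u w"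
    by (simp_all add: \<beta>_def m_def hex_polar_simps hex_add)
  have "k = 0 \<or> k = 1"
  proof (rule ccontr)
    assume "\<not> (k = 0 \<or> k = 1)"
    then consider "k \<le> - 1" | "k \<ge> 2"
      by linarith
    then show False
    proof cases
      case 1
      then have "k * \<beta> \<le> 0" "1 \<le> k * k"
        using \<beta> pos uw(2) mult_mono[of 1 "- k" 1 "- k"] by (simp_all add: mult_nonpos_nonneg)
      then have "hex m \<le> k * k * hex m"
        using pos by simp
      then show False
        using hy hyk pos \<open>k * \<beta> \<le> 0\<close> by linarith
    next
      case 2
      \<comment> \<open>Recentring at \<open>k = 1\<close>, where \<open>y = w\<close>, makes all
        terms of the quadratic nonnegative.\<close>
      define j where "j = k - 1"
      have j: "j \<ge> 1" "k = j + 1"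
        using 2 by (simp_all add: j_def)
      have "1 \<le> j * j"
        using j mult_mono[of 1 j 1 j] by simp
      then have "hex m \<le> j * j * hex m"
        using pos by simp
      moreover have "j * (2 * hex w + hex_polar u w) \<ge> 0"
        using j pos uw(2) by simp
      moreover have "hex y = hex w + j * (2 * hex w + hex_polar u w) + j * j * hex m"
        unfolding hyk j(2) \<beta> by (simp add: algebra_simps)
      ultimately show False
        using hy pos by linarith
    qed
  qed
  then have "y = - u \<or> y = w"
    using yk by (auto simp: prod_eq_iff m_def)
  then show ?thesis
    using y(2) by (auto simp: m_def insert_commute)
qed

lemma balanced_at_outer_vertex:
  assumes uw: "cross u w = 1" "hex_polar u w > 0"
    and fin: "finite (support s)" and bal: "finite_balanced s"
    and shallow: "\<And>e. e \<in> support s \<Longrightarrow> depth e \<le> nat (hex (u + w))"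
  shows "s (edge u (u + w)) + s (edge (u + w) w) = 0"
proof -
  let ?E = "{edge u (u + w), edge (u + w) w}"
  define S where "S = support s \<union> ?E"
  have E: "?E \<subseteq> farey_edges"
    using quad_edges_in_farey_edges[OF uw(1)] by simp
  then have S: "finite S" "S \<subseteq> farey_edges" "support s \<subseteq> S"
    using fin by (auto simp: S_def support_def)
  have "primitive (u + w)"
    using uw by (intro primitiveI[of _ w]) (simp add: cross_simps)
  then have "(\<Sum>e\<in>S. of_bool (ideal_point (u + w) \<in> e) * s e) = 0"
    using bal finite_balanced_iff[OF S(1,3,2)] unfolding farey_vertices_eq by blast
  moreover have "(\<Sum>e\<in>S. of_bool (ideal_point (u + w) \<in> e) * s e) =
      (\<Sum>e\<in>?E. of_bool (ideal_point (u + w) \<in> e) * s e)"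
  proof (intro sum.mono_neutral_right S(1) ballI)
    fix e assume e: "e \<in> S - ?E"
    then have "e \<in> support s"
      by (simp add: S_def)
    moreover from this have "e \<in> farey_edges"
      by (simp add: support_def)
    ultimately have "ideal_point (u + w) \<notin> e"
      using e shallow_edges_at_outer_vertex[OF uw, of e] shallow[of e] by blast
    then show "of_bool (ideal_point (u + w) \<in> e) * s e = 0"
      by simp
  qed (simp add: S_def)
  moreover have "\<dots> = s (edge u (u + w)) + s (edge (u + w) w)"
    using quad_vertices_distinct[OF uw(1)] by (subst sum.insert) (auto simp: doubleton_eq_iff)
  ultimately show ?thesis
    by simp
qed

text \<open>Such a support lies in the three sides of the base triangle. On this odd cycle, values
  that cancel at every vertex must vanish.\<close>

lemma shallow_balanced_zero:
  assumes fin: "finite (support s)" and bal: "finite_balanced s"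
    and shallow: "\<And>e. e \<in> support s \<Longrightarrow> depth e \<le> 1"
  shows "support s = {}"
proof -
  let ?S = "{{1, \<i>}, {\<i>, - 1}, {1, - 1 :: complex}}"
  have sub: "support s \<subseteq> ?S"
  proof
    fix e assume e: "e \<in> support s"
    then obtain u w where uw: "cross u w = 1" "e = edge u w"
      unfolding support_def farey_edges_eq by blast
    then have "hex u \<le> 1" "hex w \<le> 1"
      using shallow[OF e] depth_edge[of u w] by simp_all
    then have "hex u = 1" "hex w = 1"
      using uw abs_cross_1_imp(3,4)[of u w] by simp_all
    note this[THEN hex_eq_1]
    moreover have "ideal_point u \<noteq> ideal_point w"
      using uw by (intro ideal_point_neq) simp
    ultimately show "e \<in> ?S"
      unfolding uw(2) by (auto simp: doubleton_eq_iff)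
  qed
  have ne: "(1 :: complex) \<noteq> \<i>" "(1 :: complex) \<noteq> - 1" "\<i> \<noteq> - 1"
    by (simp_all add: complex_eq_iff)
  have edge: "{a, b} \<in> farey_edges" if "a \<in> {1, \<i>, - 1}" "b \<in> {1, \<i>, - 1}" "a \<noteq> b" for a b
    unfolding farey_edges_def
    by (intro CollectI exI[of _ a] exI[of _ b] conjI refl bexI[OF _ farey_triangles.base] that)
  have edges: "?S \<subseteq> farey_edges"
    using edge[of 1 \<i>] edge[of \<i> "- 1"] edge[of 1 "- 1"] ne by simp
  have V: "{1, \<i>, - 1} \<subseteq> farey_vertices"
    unfolding farey_vertices_def by (rule Union_upper[OF farey_triangles.base])
  have "(\<Sum>e\<in>?S. of_bool (v \<in> e) * s e) = 0" if "v \<in> {1, \<i>, - 1}" for v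
    using bal finite_balanced_iff[OF _ sub edges] V that by blast
  moreover have "(\<Sum>e\<in>?S. of_bool (v \<in> e) * s e) = of_bool (v \<in> {1, \<i>}) * s {1, \<i>} +
      of_bool (v \<in> {\<i>, - 1}) * s {\<i>, - 1} + of_bool (v \<in> {1, - 1}) * s {1, - 1}" for v
    using ne by (simp add: doubleton_eq_iff)
  ultimately have sums: "of_bool (v \<in> {1, \<i>}) * s {1, \<i>} +
      of_bool (v \<in> {\<i>, - 1}) * s {\<i>, - 1} + of_bool (v \<in> {1, - 1}) * s {1, - 1} = 0"
    if "v \<in> {1, \<i>, - 1}" for v
    using that by simp
  have "s {1, \<i>} + s {1, - 1} = 0" "s {1, \<i>} + s {\<i>, - 1} = 0" "s {\<i>, - 1} + s {1, - 1} = 0"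
    using sums[of 1] sums[of \<i>] sums[of "- 1"] ne ne[symmetric] by simp_all
  then have "s {1, \<i>} = 0" "s {\<i>, - 1} = 0" "s {1, - 1} = 0"
    by linarith+
  then show ?thesis
    using sub by (auto simp: support_def)
qed

text \<open>The induction weight uses base 3 because a step removes an edge of depth
  \<open>N\<close> and adds at most two of smaller depth, and
  \<open>2 * 3 ^ (N - 1) < 3 ^ N\<close>.\<close>

lemma Phi_surj_balanced:
  assumes "finite (support s)" "finite_balanced s"
  shows "\<exists>\<theta>. finite (support \<theta>) \<and> (\<forall>e\<in>farey_edges. Phi \<theta> e = s e)"
  using assms
proof (induction "\<Sum>e\<in>support s. (3::nat) ^ depth e" arbitrary: s rule: less_induct)
  case less
  note fin = \<open>finite (support s)\<close> and bal = \<open>finite_balanced s\<close>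
  show ?case
  proof (cases "\<forall>e\<in>support s. depth e \<le> 1")
    case True
    then have "support s = {}"
      using shallow_balanced_zero[OF fin bal] by blast
    then have "\<forall>e\<in>farey_edges. Phi (\<lambda>_. 0) e = s e"
      using Phi_add_mult[of _ "\<lambda>_. 0" "- 1" "\<lambda>_. 0"] by (auto simp: support_def)
    moreover have "finite (support (\<lambda>_. 0))"
      by (simp add: support_def)
    ultimately show ?thesis
      by blast
  next
    case False
    then have ne: "support s \<noteq> {}"
      by auto
    define N where "N = Max (depth ` support s)"
    have N: "depth e \<le> N" if "e \<in> support s" for e
      unfolding N_def using fin that by simp
    have "N \<in> depth ` support s"
      unfolding N_def using fin ne by (intro Max_in) auto
    then obtain f where f: "f \<in> support s" "depth f = N"
      by blast
    have "N > 1"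
      using False N by (meson le_trans not_le)
    obtain u w where uw: "cross u w = 1" "hex_polar u w > 0"
      and f_eq: "f \<in> {edge u (u + w), edge (u + w) w}"
    proof (rule farey_edge_parent)
      show "f \<in> farey_edges" "depth f > 1"
        using f \<open>N > 1\<close> by (simp_all add: support_def)
    qed
    have au: "\<bar>cross u w\<bar> = 1"
      using uw by simp
    note outer = hex_outer[OF au uw(2)]
    define e1 e2 e3 e4 where "e1 = edge u (u + w)" "e2 = edge (u + w) w"
      "e3 = edge w (w - u)" "e4 = edge (w - u) u"
    note e_defs = this
    have "\<bar>cross u (u + w)\<bar> = 1" "\<bar>cross (u + w) w\<bar> = 1" "\<bar>cross w (w - u)\<bar> = 1"
      "\<bar>cross (w - u) u\<bar> = 1"
      using uw by (simp_all add: cross_simps cross_commute[of w u])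
    note d = this[THEN depth_edge]
    have "depth e1 = nat (hex (u + w))" "depth e2 = nat (hex (u + w))"
      unfolding e_defs d using outer by simp_all
    moreover from this have N_eq: "N = nat (hex (u + w))"
      using f f_eq by (auto simp: e_defs)
    ultimately have depth12: "depth e1 = N" "depth e2 = N"
      by simp_all
    have "depth e3 < N" "depth e4 < N"
      unfolding e_defs d N_eq using outer hex_inner[OF au uw(2)] hex_nonneg[of u] by simp_all
    then have "(3::nat) ^ depth e3 \<le> 3 ^ (N - 1)" "(3::nat) ^ depth e4 \<le> 3 ^ (N - 1)"
      by (simp_all add: power_increasing)
    moreover have "(3::nat) ^ N = 3 * 3 ^ (N - 1)"
      using \<open>N > 1\<close> by (simp flip: power_Suc)
    moreover have "(3::nat) ^ (N - 1) > 0"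
      by simp
    ultimately have pow: "(3::nat) ^ depth e3 + 3 ^ depth e4 < 3 ^ N"
      by linarith
    have dist: "e1 \<noteq> e2" "e1 \<noteq> e3" "e1 \<noteq> e4" "e2 \<noteq> e3" "e2 \<noteq> e4" "e3 \<noteq> e4"
      using quad_vertices_distinct[OF uw(1)] unfolding e_defs by (auto simp: doubleton_eq_iff)
    have e_edges: "e1 \<in> farey_edges" "e2 \<in> farey_edges"
      using quad_edges_in_farey_edges[OF uw(1)] by (simp_all add: e_defs)
    \<comment> \<open>Subtracting \<open>t\<close> times \<open>quad_shear u w\<close> clears
      \<open>e1\<close> by this choice, and \<open>e2\<close> because balance gives it the value
      \<open>- t\<close>.\<close>
    define t where "t = s e1"
    have s2: "s e2 = - t"
      using balanced_at_outer_vertex[OF uw fin bal] N unfolding N_eq t_def e_defs by simp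
    have "t \<noteq> 0"
      using f f_eq s2 by (auto simp: support_def t_def e_defs)
    then have e1: "e1 \<in> support s"
      using e_edges by (simp add: support_def t_def)
    define s' where "s' = (\<lambda>f. s f - t * quad_shear u w f)"
    have shear: "quad_shear u w f = of_bool (f = e1) - of_bool (f = e2) + of_bool (f = e3) -
        of_bool (f = e4)" for f
      by (simp add: quad_shear_def e_defs)
    have sub: "support s' \<subseteq> (support s - {e1}) \<union> {e3, e4}"
      using dist s2 by (auto simp: support_def s'_def shear t_def split: if_splits)
    then have fin': "finite (support s')"
      by (rule finite_subset) (simp add: fin)
    have "(\<Sum>e\<in>support s'. (3::nat) ^ depth e) \<le> (\<Sum>e\<in>(support s - {e1}) \<union> {e3, e4}. 3 ^ depth e)"
      using fin sub by (intro sum_mono2) auto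
    also have "\<dots> \<le> (\<Sum>e\<in>support s - {e1}. 3 ^ depth e) + (\<Sum>e\<in>{e3, e4}. 3 ^ depth e)"
      using fin sum.union_inter[of "support s - {e1}" "{e3, e4}" "\<lambda>e. (3::nat) ^ depth e"] by simp
    also have "\<dots> < (\<Sum>e\<in>support s - {e1}. 3 ^ depth e) + 3 ^ depth e1"
      using pow dist(6) depth12 by simp
    also have "\<dots> = (\<Sum>e\<in>support s. 3 ^ depth e)"
      using fin e1 by (simp add: sum.remove)
    finally have "(\<Sum>e\<in>support s'. (3::nat) ^ depth e) < (\<Sum>e\<in>support s. 3 ^ depth e)" .
    moreover have "finite_balanced s'"
      unfolding s'_def using uw(1) fin bal by (rule finite_balanced_diff_quad_shear)
    ultimately obtain \<theta> where \<theta>: "finite (support \<theta>)" "\<And>e. e \<in> farey_edges \<Longrightarrow> Phi \<theta> e = s' e"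
      using less.hyps[of s'] fin' by blast
    \<comment> \<open>By \<open>Phi_of_bool\<close>, the multiple of the indicator restores exactly
      what was subtracted from \<open>s\<close>.\<close>
    define \<theta>' where "\<theta>' = (\<lambda>f. \<theta> f + t * of_bool (f = edge u w))"
    have "Phi \<theta>' e = s e" if "e \<in> farey_edges" for e
      unfolding \<theta>'_def Phi_add_mult[OF that] Phi_of_bool[OF uw(1) that] \<theta>(2)[OF that]
      by (simp add: s'_def)
    moreover have "support \<theta>' \<subseteq> insert (edge u w) (support \<theta>)"
      by (auto simp: support_def \<theta>'_def)
    then have "finite (support \<theta>')"
      by (rule finite_subset) (simp add: \<theta>(1))
    ultimately show ?thesis
      by blast
  qed
qed

section \<open>Existence and uniqueness among extensional functions\<close>

theorem proposition3p6:
  fixes s :: "complex set \<Rightarrow> real"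
  assumes "s \<in> farey_edges \<rightarrow>\<^sub>E UNIV"
    and "finite (support s)"
    and "finite_balanced s"
  shows "\<exists>!\<theta>. \<theta> \<in> farey_edges \<rightarrow>\<^sub>E UNIV \<and> finite (support \<theta>) \<and> Phi \<theta> = s"
proof (rule ex_ex1I)
  obtain \<theta> where \<theta>: "finite (support \<theta>)" "\<And>e. e \<in> farey_edges \<Longrightarrow> Phi \<theta> e = s e"
    using Phi_surj_balanced assms(2,3) by blast
  have "support (restrict \<theta> farey_edges) = support \<theta>"
    by (auto simp: support_def)
  moreover have "Phi (restrict \<theta> farey_edges) = s"
    unfolding Phi_restrict
  proof
    fix e
    \<comment> \<open>Off the edges both sides are \<open>undefined\<close>.\<close>
    show "Phi \<theta> e = s e"
      using \<theta>(2) PiE_arb[OF assms(1)] by (cases "e \<in> farey_edges") (auto simp: Phi_def)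
  qed
  ultimately show "\<exists>\<theta>. \<theta> \<in> farey_edges \<rightarrow>\<^sub>E UNIV \<and> finite (support \<theta>) \<and> Phi \<theta> = s"
    using \<theta>(1) by (intro exI[of _ "restrict \<theta> farey_edges"]) simp
next
  fix \<theta> \<eta>
  assume \<theta>: "\<theta> \<in> farey_edges \<rightarrow>\<^sub>E UNIV \<and> finite (support \<theta>) \<and> Phi \<theta> = s"
    and \<eta>: "\<eta> \<in> farey_edges \<rightarrow>\<^sub>E UNIV \<and> finite (support \<eta>) \<and> Phi \<eta> = s"
  \<comment> \<open>The difference is written so that \<open>Phi_add_mult\<close> applies.\<close>
  let ?\<delta> = "\<lambda>f. \<theta> f + (- 1) * \<eta> f"
  have "support ?\<delta> \<subseteq> support \<theta> \<union> support \<eta>"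
    by (auto simp: support_def)
  then have "finite (support ?\<delta>)"
    using \<theta> \<eta> by (meson finite_UnI finite_subset)
  moreover have "Phi ?\<delta> e = 0" if "e \<in> farey_edges" for e
    unfolding Phi_add_mult[OF that] using \<theta> \<eta> by simp
  ultimately have "support ?\<delta> = {}"
    by (rule Phi_zero)
  then have "\<theta> e = \<eta> e" if "e \<in> farey_edges" for e
    using that by (auto simp: support_def)
  then show "\<theta> = \<eta>"
    using \<theta> \<eta> by (intro PiE_ext[of \<theta> farey_edges "\<lambda>_. UNIV" \<eta>]) auto
qed

end
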